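(* Let $1\le i\le j\le d$. Then for any $p\in\overline{\mathcal{P}^+_i}$ and $q\in\overline{\mathcal{P}^+_j}$, we have $[p\boxplus_d^n q](x)\in\overline{\mathcal{P}^+_{i+j-d}}$.
   Context: Here $d$, $i$, $j$ and $n\ge 0$ are integers. For $k\ge 1$, $\mathcal{P}^+_k$ is the collection of degree $k$ polynomials with real coefficients such that all roots are nonnegative (real), at least one root is positive, and the coefficient of $x^k$ is positive. For all $k\le 0$, $\mathcal{P}^+_k$ is set to consist of the constant $0$ polynomial only. The bar denotes closure: for $k\ge 1$, the closure $\overline{\mathcal{P}^+_k}$ adds to $\mathcal{P}^+_k$ only the polynomial $x^k$ (up to positive constant multiples); for $k\le 0$, $\overline{\mathcal{P}^+_k}=\{0\}$. Rectangular additive convolution: for $i,j\le d$ and $n\ge 0$, the operation $\boxplus_d^n$ on polynomials of degree at most $d$ is the (bi)linear extension of $$[x^i \boxplus_d^n x^j](y)=\frac{(n+i)!\,(n+j)!\,i!\,j!}{(d+n)!\,d!\,(i+j-d)!\,(n+i+j-d)!}\,y^{i+j-d}\ \text{ if } i+j\ge d,\qquad [x^i \boxplus_d^n x^j](y)=0\ \text{ otherwise.}$$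
   Formalization: When i+j=d the claim as stated is false, since the convolution is a nonzero constant while the closure of P^+_0 is {0} (for d=2, n=0, p=q=x it is 1/4); in that case the conclusion is replaced by "is a positive constant". *)

theory Defs
  imports "HOL-Computational_Algebra.Polynomial" Complex_Main
begin

text \<open>The index \<open>k\<close> is an integer because the product of degrees \<open>i\<close> and \<open>j\<close> lands in
  index \<open>i + j - d\<close>, which may be negative. ``All roots are nonnegative real'' refers to all
  complex roots.\<close>

definition Pplus :: "int \<Rightarrow> real poly set" where
  "Pplus k =
    (if k \<ge> 1 then
       {p. int (degree p) = k \<and> lead_coeff p > 0 \<and>
           (\<forall>z::complex. poly (map_poly complex_of_real p) z = 0 \<longrightarrow> z \<in> \<real> \<and> Re z \<ge> 0) \<and>
           (\<exists>x::real. x > 0 \<and> poly p x = 0)}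
     else {0})"

text \<open>This is the closure among polynomials of degree exactly \<open>k\<close> with positive leading
  coefficient: for \<open>k \<ge> 1\<close> it adds only the positive multiples of \<open>x\<^sup>k\<close>.\<close>

definition Pplus_closure :: "int \<Rightarrow> real poly set" where
  "Pplus_closure k =
    (if k \<ge> 1 then Pplus k \<union> {monom c (nat k) | c. c > 0} else {0})"

definition rect_conv_monom :: "nat \<Rightarrow> nat \<Rightarrow> nat \<Rightarrow> nat \<Rightarrow> real poly" where
  "rect_conv_monom d n i j =
    (if i + j \<ge> d then
       monom ((fact (n + i) * fact (n + j) * fact i * fact j) /
              (fact (d + n) * fact d * fact (i + j - d) * fact (n + i + j - d))) (i + j - d)
     else 0)"

text \<open>The bilinear extension to polynomials of degree at most \<open>d\<close>; coefficients above \<open>d\<close>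
  are ignored, so the definition is only meaningful on such polynomials.\<close>

definition rect_conv :: "nat \<Rightarrow> nat \<Rightarrow> real poly \<Rightarrow> real poly \<Rightarrow> real poly" where
  "rect_conv d n p q =
    (\<Sum>i\<le>d. \<Sum>j\<le>d. smult (coeff p i * coeff q j) (rect_conv_monom d n i j))"

text \<open>When \<open>i + j = d\<close> the convolution is a nonzero constant, which does not belong to
  \<open>Pplus_closure 0 = {0}\<close>. So closedness of these sets under the convolution needs a separate
  clause for this borderline case, as the following instance shows.\<close>

lemma rect_conv_borderline:
  "monom 1 1 \<in> Pplus_closure 1"
  "rect_conv 2 0 (monom 1 1) (monom 1 1) = [:1/4:]"
  "rect_conv 2 0 (monom 1 1) (monom 1 1) \<notin> Pplus_closure 0"
proof -
  show "monom 1 1 \<in> Pplus_closure 1"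
    by (auto simp: Pplus_closure_def)
  show *: "rect_conv 2 0 (monom 1 1) (monom 1 1) = [:1/4:]"
    by (simp add: rect_conv_def rect_conv_monom_def numeral_2_eq_2 monom_0)
  show "rect_conv 2 0 (monom 1 1) (monom 1 1) \<notin> Pplus_closure 0"
    unfolding * by (simp add: Pplus_closure_def)
qed

end

theory Submission
  imports Defs "HOL-Analysis.Complex_Analysis_Basics"
    "HOL-Computational_Algebra.Fundamental_Theorem_Algebra"
begin

text \<open>Let \<open>H\<close> be the open upper half plane. A product of two points of \<open>H\<close> is never a nonnegative
  real, and every complex number outside \<open>[0, \<infinity>)\<close> is such a product. Hence \<open>p\<close> has only nonnegative
  real roots iff \<open>y\<^sup>n p(x y)\<close> has no zero in \<open>H \<times> H\<close>. In these two-variable terms the rectangular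
  convolution becomes Walsh's additive convolution, of degree \<open>d\<close> in \<open>x\<close> and of degree \<open>d + n\<close>
  in \<open>y\<close>. The value of the convolution at a point of \<open>H \<times> H\<close> is computed by peeling off the factors
  \<open>x y - a\<close> of \<open>p(x y)\<close> one at a time: each of them replaces the other operand \<open>g\<close> by
  \<open>P\<^sub>x P\<^sub>y g - a \<partial>\<^sub>x \<partial>\<^sub>y g\<close>, where \<open>P\<close> is the polar derivative whose pole is the evaluation point.
  By Laguerre's theorem and an argument in the style of Lieb and Sokal this operation preserves the
  absence of zeros in \<open>H \<times> H\<close>. If \<open>deg p < d\<close>, then \<open>d\<close> is lowered by applying
  \<open>x D\<^sup>2 + (n + 1) D\<close> to \<open>q\<close>, which preserves nonnegative roots by the Gauss-Lucas theorem.\<close>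

subsection \<open>Laguerre's theorem\<close>

text \<open>The quotient \<open>q' / q\<close> is the sum of \<open>1 / (x - b)\<close> over the
  roots \<open>b\<close> with multiplicity, so division by the degree makes it a mean of points of
  \<open>K\<close>. A disk as \<open>K\<close> yields Laguerre's theorem, half planes yield the
  Gauss-Lucas theorem.\<close>

lemma log_deriv_in_convex:
  fixes K :: "complex set"
  assumes "convex K" "degree q = Suc m" "poly q x \<noteq> 0"
    and "\<And>b. poly q b = 0 \<Longrightarrow> 1 / (x - b) \<in> K"
  shows "poly (pderiv q) x / poly q x / of_nat (Suc m) \<in> K"
  using assms(2-4)
proof (induction m arbitrary: q)
  case (Suc m)
  obtain b where b: "poly q b = 0"
    using fundamental_theorem_of_algebra[of q] Suc.prems(1) by (auto simp: constant_degree)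
  obtain r where r: "q = [:-b, 1:] * r"
    using b by (metis dvdE poly_eq_0_iff_dvd)
  have dq: "pderiv q = r + [:-b, 1:] * pderiv r"
    unfolding r pderiv_mult by (simp add: pderiv_pCons)
  have nz: "x \<noteq> b" "poly r x \<noteq> 0" "r \<noteq> 0" using Suc.prems(2) r by auto
  have "degree r = Suc m"
    using Suc.prems(1) r nz(3) by (simp add: degree_mult_eq del: mult_pCons_left)
  moreover have "1 / (x - c) \<in> K" if "poly r c = 0" for c
    using Suc.prems(3)[of c] that r by simp
  ultimately have IH: "poly (pderiv r) x / poly r x / of_nat (Suc m) \<in> K"
    using Suc.IH nz by blast
  have bK: "1 / (x - b) \<in> K" using Suc.prems(3) b by blast
  let ?M = "real m"
  have "poly (pderiv q) x / poly q x = 1 / (x - b) + poly (pderiv r) x / poly r x"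
    using nz unfolding dq by (simp add: r field_simps)
  moreover have "(u + v) / of_nat (Suc (Suc m))
      = (1 / (?M + 2)) *\<^sub>R u + ((?M + 1) / (?M + 2)) *\<^sub>R (v / of_nat (Suc m))" for u v :: complex
  proof -
    have M: "complex_of_nat (Suc (Suc m)) = of_real (?M + 2)" "complex_of_nat (Suc m) = of_real (?M + 1)"
      by simp_all
    have "?M + 2 \<noteq> 0" "?M + 1 \<noteq> 0" by linarith+
    then show ?thesis
      unfolding M scaleR_conv_of_real of_real_divide of_real_1
      by (simp add: add_divide_distrib del: of_real_add)
  qed
  ultimately have "poly (pderiv q) x / poly q x / of_nat (Suc (Suc m))
      = (1 / (?M + 2)) *\<^sub>R (1 / (x - b))
        + ((?M + 1) / (?M + 2)) *\<^sub>R (poly (pderiv r) x / poly r x / of_nat (Suc m))"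
    by metis
  also have "\<dots> \<in> K"
    by (rule convexD[OF assms(1) bK IH]) (auto simp: field_simps)
  finally show ?case .
next
  case 0
  obtain b where b: "poly q b = 0"
    using fundamental_theorem_of_algebra[of q] "0.prems"(1) by (auto simp: constant_degree)
  obtain r where r: "q = [:-b, 1:] * r"
    using b by (metis dvdE poly_eq_0_iff_dvd)
  have dq: "pderiv q = r + [:-b, 1:] * pderiv r"
    unfolding r pderiv_mult by (simp add: pderiv_pCons)
  have nz: "x \<noteq> b" "poly r x \<noteq> 0" "r \<noteq> 0" using 0(2) r by auto
  have "degree r = 0"
    using 0(1) r nz(3) by (simp add: degree_mult_eq del: mult_pCons_left)
  then have "pderiv r = 0" by (simp add: pderiv_eq_0_iff)
  then have "poly (pderiv q) x / poly q x = 1 / (x - b)"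
    using nz unfolding dq by (simp add: r field_simps)
  then show ?case using 0(3)[OF b] by simp
qed

text \<open>Both sides say that \<open>z\<close> is at least as close to \<open>2 * h * \<i>\<close>
  as to \<open>0\<close>. The disk has the points \<open>0\<close> and \<open>- \<i> / h\<close> as
  ends of a diameter.\<close>

lemma inverse_upper_half_plane_in_cball_iff:
  assumes "h > 0" "z \<noteq> 0"
  shows "1 / z \<in> cball (- \<i> / of_real (2 * h)) (1 / (2 * h)) \<longleftrightarrow> h \<le> Im z"
proof -
  have nz: "cmod z > 0" using assms by simp
  have "1 / z \<in> cball (- \<i> / of_real (2 * h)) (1 / (2 * h))
      \<longleftrightarrow> cmod (1 / z + \<i> / of_real (2 * h)) \<le> 1 / (2 * h)"
    by (simp add: dist_norm norm_minus_commute add.commute)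
  also have "1 / z + \<i> / of_real (2 * h) = (of_real (2 * h) + \<i> * z) / (of_real (2 * h) * z)"
    using assms by (simp add: field_simps)
  also have "cmod \<dots> = cmod (of_real (2 * h) + \<i> * z) / (2 * h * cmod z)"
    using assms(1) by (simp add: norm_divide norm_mult)
  also have "\<dots> \<le> 1 / (2 * h) \<longleftrightarrow> cmod (of_real (2 * h) + \<i> * z) \<le> cmod z"
    using assms(1) nz by (simp add: field_simps)
  also have "\<dots> \<longleftrightarrow> (cmod (of_real (2 * h) + \<i> * z))\<^sup>2 \<le> (cmod z)\<^sup>2"
    by (simp add: abs_le_square_iff[symmetric])
  also have "\<dots> \<longleftrightarrow> 4 * h * h \<le> 4 * h * Im z"
    unfolding cmod_power2 by (simp add: power2_eq_square algebra_simps)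
  also have "\<dots> \<longleftrightarrow> h \<le> Im z" using assms(1) by simp
  finally show ?thesis .
qed

text \<open>Vanishing would mean \<open>q' / (d q) = 1 / (x - \<zeta>)\<close> at \<open>x\<close>.
  The left side lies in the disk \<open>K\<close>, because \<open>Im (x - b) \<ge> Im x\<close> for
  every root \<open>b\<close>; the right side does not, because
  \<open>Im (x - \<zeta>) < Im x\<close>.\<close>

lemma polar_derivative_nonzero:
  fixes q :: "complex poly"
  assumes deg: "degree q \<le> d" and "0 < d"
    and q: "\<And>z. Im z > 0 \<Longrightarrow> poly q z \<noteq> 0"
    and "Im x > 0" "Im \<zeta> > 0"
  shows "of_nat d * poly q x - (x - \<zeta>) * poly (pderiv q) x \<noteq> 0"
proof
  assume eq: "of_nat d * poly q x - (x - \<zeta>) * poly (pderiv q) x = 0"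
  define K where "K = cball (- \<i> / of_real (2 * Im x)) (1 / (2 * Im x))"
  have K: "convex K" "0 \<in> K" using \<open>Im x > 0\<close> by (auto simp: K_def norm_divide)
  have qx: "poly q x \<noteq> 0" using q \<open>Im x > 0\<close> by blast
  with eq \<open>0 < d\<close> have nz: "x \<noteq> \<zeta>" "poly (pderiv q) x \<noteq> 0" by auto
  then have "degree q \<noteq> 0" by (auto simp: pderiv_eq_0_iff[symmetric])
  then obtain m where m: "degree q = Suc m" by (cases "degree q") auto
  have "1 / (x - b) \<in> K" if "poly q b = 0" for b
  proof -
    have "Im b \<le> 0" using q that not_le by blast
    moreover have "x - b \<noteq> 0" using that qx by auto
    ultimately show ?thesis
      unfolding K_def using inverse_upper_half_plane_in_cball_iff[OF \<open>Im x > 0\<close>, of "x - b"] by simp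
  qed
  then have "poly (pderiv q) x / poly q x / of_nat (Suc m) \<in> K"
    using log_deriv_in_convex[OF K(1) m qx] by blast
  \<comment> \<open>If \<open>degree q < d\<close>, the missing roots lie at infinity and enter the
    mean as the point \<open>0\<close> of \<open>K\<close>.\<close>
  then have "(real (Suc m) / real d) *\<^sub>R (poly (pderiv q) x / poly q x / of_nat (Suc m))
      + (1 - real (Suc m) / real d) *\<^sub>R 0 \<in> K"
    by (rule convexD[OF K(1) _ K(2)]) (use deg m \<open>0 < d\<close> in auto)
  also have "(real (Suc m) / real d) *\<^sub>R (poly (pderiv q) x / poly q x / of_nat (Suc m))
      + (1 - real (Suc m) / real d) *\<^sub>R 0 = poly (pderiv q) x / poly q x / of_nat d"
    by (simp add: scaleR_conv_of_real del: of_nat_Suc)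
  also have "\<dots> = 1 / (x - \<zeta>)"
    using eq nz qx \<open>0 < d\<close> by (simp add: field_simps)
  finally show False
    unfolding K_def using inverse_upper_half_plane_in_cball_iff[OF \<open>Im x > 0\<close>, of "x - \<zeta>"] nz \<open>Im \<zeta> > 0\<close>
    by simp
qed

subsection \<open>Zero-free polynomials on the product of two half planes\<close>

text \<open>If the expression vanishes at \<open>(x, y)\<close>, then the biaffine form itself vanishes at \<open>(x, y')\<close>
  with \<open>y' = y - a / G\<close>, and \<open>Im G > 0\<close> because the pole \<open>- \<gamma> / \<delta>\<close> of the zero curve cannot lie
  in the upper half plane.\<close>

lemma biaffine_nonzero:
  fixes \<alpha> \<beta> \<gamma> \<delta> :: complex
  assumes nz: "\<And>x y. Im x > 0 \<Longrightarrow> Im y > 0 \<Longrightarrow> \<alpha> + \<beta> * x + \<gamma> * y + \<delta> * x * y \<noteq> 0"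
    and xy: "Im x > 0" "Im y > 0" and "a \<ge> 0"
  shows "\<alpha> + \<beta> * x + \<gamma> * y + \<delta> * x * y - of_real a * \<delta> \<noteq> 0"
proof
  assume eq: "\<alpha> + \<beta> * x + \<gamma> * y + \<delta> * x * y - of_real a * \<delta> = 0"
  then have d: "\<delta> \<noteq> 0" using nz[OF xy] by auto
  have im: "Im (\<gamma> / \<delta>) \<ge> 0"
  proof (rule ccontr)
    assume "\<not> ?thesis"
    then have pos: "Im (- \<gamma> / \<delta>) > 0" by simp
    \<comment> \<open>Solving for \<open>x\<close> at \<open>y = \<i> / s\<close> gives
      \<open>- ?N s / ?D s\<close>, which tends to the pole \<open>- \<gamma> / \<delta>\<close> as
      \<open>s\<close> decreases to \<open>0\<close>. If the pole were in the upper half plane, some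
      small \<open>s\<close> would give a forbidden zero.\<close>
    let ?N = "\<lambda>s::real. \<alpha> * of_real s + \<gamma> * \<i>" and ?D = "\<lambda>s::real. \<beta> * of_real s + \<delta> * \<i>"
    have N: "(?N \<longlongrightarrow> \<alpha> * of_real 0 + \<gamma> * \<i>) (at_right 0)"
      and D: "(?D \<longlongrightarrow> \<beta> * of_real 0 + \<delta> * \<i>) (at_right 0)"
      by (intro tendsto_intros)+
    have D0: "\<beta> * of_real 0 + \<delta> * \<i> \<noteq> 0" using d by simp
    have "((\<lambda>s. Im (- ?N s / ?D s)) \<longlongrightarrow> Im (- (\<alpha> * of_real 0 + \<gamma> * \<i>) / (\<beta> * of_real 0 + \<delta> * \<i>))) (at_right 0)"
      by (intro tendsto_Im tendsto_divide tendsto_minus N D D0)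
    then have "\<forall>\<^sub>F s in at_right 0. Im (- ?N s / ?D s) > 0"
      by (rule order_tendstoD) (use pos in simp)
    moreover have "\<forall>\<^sub>F s in at_right 0. ?D s \<noteq> 0"
      by (rule tendsto_imp_eventually_ne[OF D D0])
    moreover have "\<forall>\<^sub>F s::real in at_right 0. s > 0"
      by (rule eventually_at_right_less)
    ultimately have "\<forall>\<^sub>F s in at_right 0. Im (- ?N s / ?D s) > 0 \<and> ?D s \<noteq> 0 \<and> s > 0"
      by (intro eventually_conj)
    then obtain s where s: "Im (- ?N s / ?D s) > 0" "?D s \<noteq> 0" "s > 0"
      using eventually_happens[of _ "at_right (0::real)"] by auto
    define z where "z = - ?N s / ?D s"
    have "?N s + z * ?D s = 0" using s(2) by (simp add: z_def)
    then have "(?N s + z * ?D s) / of_real s = 0" by simp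
    then have "\<alpha> + \<beta> * z + \<gamma> * (\<i> / of_real s) + \<delta> * z * (\<i> / of_real s) = 0"
      using s(3) by (simp add: field_simps)
    moreover have "Im z > 0" "Im (\<i> / of_real s) > 0" using s by (simp_all add: z_def)
    ultimately show False using nz by blast
  qed
  define G where "G = x + \<gamma> / \<delta>"
  have G: "Im G > 0" using im xy by (simp add: G_def)
  then have G0: "G \<noteq> 0" by auto
  define y' where "y' = y - of_real a / G"
  have "Im (of_real a / G) \<le> 0"
    using G \<open>a \<ge> 0\<close> by (simp add: Im_divide mult_nonneg_nonneg)
  then have "Im y' > 0" using xy by (simp add: y'_def)
  moreover have "\<alpha> + \<beta> * x + \<gamma> * y' + \<delta> * x * y' = 0" 
  proof -
    have "\<alpha> + \<beta> * x + \<gamma> * y' + \<delta> * x * y' = \<alpha> + \<beta> * x + \<gamma> * y + \<delta> * x * y - \<delta> * G * (of_real a / G)"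
    proof -
      have "\<delta> * G = \<gamma> + \<delta> * x" using d by (simp add: G_def algebra_simps)
      then show ?thesis by (simp add: y'_def algebra_simps)
    qed
    also have "\<delta> * G * (of_real a / G) = of_real a * \<delta>" using G0 by simp
    finally show ?thesis using eq by simp
  qed
  ultimately show False using nz xy(1) by blast
qed

text \<open>Bare coefficient functions allow a two-variable polynomial to be read in either variable
  first. The explicit bound drops by one with each polar derivative, whatever the actual degree
  is.\<close>

definition trunc_eval :: "nat \<Rightarrow> (nat \<Rightarrow> complex) \<Rightarrow> complex \<Rightarrow> complex" where
  "trunc_eval d c x = (\<Sum>i\<le>d. c i * x ^ i)"

text \<open>The coefficients of the polar derivative \<open>d q - (x - \<zeta>) q'\<close> with pole \<open>\<zeta>\<close>.\<close>

definition polar :: "nat \<Rightarrow> complex \<Rightarrow> (nat \<Rightarrow> complex) \<Rightarrow> nat \<Rightarrow> complex" where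
  "polar d \<zeta> c i = of_nat (d - i) * c i + \<zeta> * (of_nat (Suc i) * c (Suc i))"

lemma trunc_eval_add: "trunc_eval d (\<lambda>i. f i + g i) x = trunc_eval d f x + trunc_eval d g x"
  by (simp add: trunc_eval_def sum.distrib algebra_simps)

lemma trunc_eval_cmult: "trunc_eval d (\<lambda>i. k * f i) x = k * trunc_eval d f x"
  by (simp add: trunc_eval_def sum_distrib_left algebra_simps)

lemma trunc_eval_swap: "trunc_eval d (\<lambda>i. trunc_eval e (c i) y) x = trunc_eval e (\<lambda>l. trunc_eval d (\<lambda>i. c i l) x) y"
  unfolding trunc_eval_def sum_distrib_right by (subst sum.swap) (simp add: mult_ac)

lemma trunc_eval_polar_swap:
  "trunc_eval e (polar m \<zeta> (\<lambda>l. trunc_eval d (\<lambda>i. c i l) x)) y = trunc_eval d (\<lambda>i. trunc_eval e (polar m \<zeta> (c i)) y) x"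
  by (simp add: polar_def[abs_def] trunc_eval_add trunc_eval_cmult trunc_eval_swap[of d])

lemma polar_trunc_eval: "polar m \<zeta> (\<lambda>i. trunc_eval e (c i) y) i = trunc_eval e (\<lambda>l. polar m \<zeta> (\<lambda>i. c i l) i) y"
  by (simp add: polar_def trunc_eval_add trunc_eval_cmult)

lemma trunc_eval_polar_eq:
  fixes c :: "nat \<Rightarrow> complex" and d :: nat
  defines "q \<equiv> \<Sum>i\<le>Suc d. monom (c i) i"
  shows "trunc_eval d (polar (Suc d) \<zeta> c) x
    = of_nat (Suc d) * poly q x - (x - \<zeta>) * poly (pderiv q) x"
proof -
  have q: "poly q x = (\<Sum>i\<le>Suc d. c i * x ^ i)"
    by (simp add: q_def poly_sum poly_monom del: sum.atMost_Suc)
  have "poly (pderiv q) x = (\<Sum>i\<le>Suc d. of_nat i * c i * x ^ (i - 1))"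
    using higher_pderiv_sum[of 1 "\<lambda>i. monom (c i) i" "{..Suc d}"]
    by (simp add: q_def pderiv_monom poly_sum poly_monom del: sum.atMost_Suc)
  then have q': "poly (pderiv q) x = (\<Sum>i\<le>d. of_nat (Suc i) * c (Suc i) * x ^ i)"
    by (simp only: sum.atMost_Suc_shift) simp
  have "x * poly (pderiv q) x = (\<Sum>i\<le>Suc d. of_nat i * c i * x ^ i)"
    unfolding q' by (simp only: sum.atMost_Suc_shift) (simp add: sum_distrib_left algebra_simps)
  then have "of_nat (Suc d) * poly q x - x * poly (pderiv q) x
      = (\<Sum>i\<le>Suc d. (of_nat (Suc d) - of_nat i) * c i * x ^ i)"
    unfolding q by (simp add: sum_distrib_left sum_subtractf left_diff_distrib mult.assoc del: sum.atMost_Suc of_nat_Suc)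
  also have "\<dots> = (\<Sum>i\<le>d. of_nat (Suc d - i) * c i * x ^ i)"
    by (auto intro!: sum.cong simp: of_nat_diff)
  finally have "of_nat (Suc d) * poly q x - (x - \<zeta>) * poly (pderiv q) x
      = (\<Sum>i\<le>d. of_nat (Suc d - i) * c i * x ^ i) + \<zeta> * poly (pderiv q) x"
    by (simp add: left_diff_distrib)
  also have "\<dots> = trunc_eval d (polar (Suc d) \<zeta> c) x"
    unfolding q' trunc_eval_def polar_def by (simp add: sum.distrib sum_distrib_left distrib_right distrib_left mult_ac del: of_nat_Suc)
  finally show ?thesis ..
qed

lemma trunc_eval_polar_nonzero:
  assumes "\<And>z. Im z > 0 \<Longrightarrow> trunc_eval (Suc d) c z \<noteq> 0" "Im \<zeta> > 0" "Im x > 0"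
  shows "trunc_eval d (polar (Suc d) \<zeta> c) x \<noteq> 0"
  unfolding trunc_eval_polar_eq
proof (rule polar_derivative_nonzero)
  show "degree (\<Sum>i\<le>Suc d. monom (c i) i) \<le> Suc d"
    by (intro degree_sum_le) (auto intro: order.trans[OF degree_monom_le])
qed (use assms in \<open>simp_all add: trunc_eval_def poly_sum poly_monom\<close>)

definition stable2 :: "nat \<Rightarrow> nat \<Rightarrow> (nat \<Rightarrow> nat \<Rightarrow> complex) \<Rightarrow> bool" where
  "stable2 d e c \<longleftrightarrow> (\<forall>x y. Im x > 0 \<longrightarrow> Im y > 0 \<longrightarrow> trunc_eval d (\<lambda>i. trunc_eval e (c i) y) x \<noteq> 0)"

text \<open>Laguerre's theorem is applied in \<open>y\<close> for fixed \<open>x\<close>, and then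
  in \<open>x\<close> for fixed \<open>y\<close>.\<close>

lemma stable2_polar:
  assumes "stable2 (Suc d) (Suc e) c" "Im \<zeta> > 0" "Im \<omega> > 0"
  shows "stable2 d e (\<lambda>i l. polar (Suc d) \<zeta> (\<lambda>i. polar (Suc e) \<omega> (c i) l) i)"
  unfolding stable2_def
proof (intro allI impI)
  fix x y :: complex assume "Im x > 0" "Im y > 0"
  have "trunc_eval (Suc d) (\<lambda>i. trunc_eval e (polar (Suc e) \<omega> (c i)) y) z \<noteq> 0" if "Im z > 0" for z
    unfolding trunc_eval_polar_swap[symmetric]
    using assms that \<open>Im y > 0\<close>
    by (intro trunc_eval_polar_nonzero) (auto simp: stable2_def trunc_eval_swap[of "Suc d"])
  then show "trunc_eval d (\<lambda>i. trunc_eval e (\<lambda>l. polar (Suc d) \<zeta> (\<lambda>i. polar (Suc e) \<omega> (c i) l) i) y) x \<noteq> 0"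
    unfolding polar_trunc_eval[symmetric] using assms \<open>Im x > 0\<close> by (intro trunc_eval_polar_nonzero)
qed

text \<open>The effect on \<open>c\<close> of one factor \<open>x y - a\<close> of the other operand.\<close>

definition peel :: "nat \<Rightarrow> nat \<Rightarrow> complex \<Rightarrow> complex \<Rightarrow> complex \<Rightarrow> (nat \<Rightarrow> nat \<Rightarrow> complex) \<Rightarrow> nat \<Rightarrow> nat \<Rightarrow> complex" where
  "peel d e x y a c i l = polar d x (\<lambda>i. polar e y (c i) l) i
     - a * (of_nat (Suc i) * (of_nat (Suc l) * c (Suc i) (Suc l)))"

text \<open>At a fixed \<open>(x, y)\<close> the double polar derivative is biaffine in its two
  poles, and \<open>stable2_polar\<close> excludes zeros for poles in the upper half plane. The
  coefficient of the product of the poles is the mixed derivative, so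
  \<open>biaffine_nonzero\<close> applies with the poles as variables.\<close>

lemma stable2_peel:
  assumes "stable2 (Suc d) (Suc e) c" "Im \<zeta> > 0" "Im \<omega> > 0" "a \<ge> 0"
  shows "stable2 d e (peel (Suc d) (Suc e) \<zeta> \<omega> (of_real a) c)"
  unfolding stable2_def
proof (intro allI impI)
  fix x y :: complex assume xy: "Im x > 0" "Im y > 0"
  define A where "A f = trunc_eval d (\<lambda>i. trunc_eval e (f i) y) x" for f :: "nat \<Rightarrow> nat \<Rightarrow> complex"
  define f1 where "f1 i l = of_nat (Suc d - i) * (of_nat (Suc e - l) * c i l)" for i l
  define f2 where "f2 i l = of_nat (Suc i) * (of_nat (Suc e - l) * c (Suc i) l)" for i l
  define f3 where "f3 i l = of_nat (Suc d - i) * (of_nat (Suc l) * c i (Suc l))" for i l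
  define f4 where "f4 i l = of_nat (Suc i) * (of_nat (Suc l) * c (Suc i) (Suc l))" for i l
  have pol: "polar (Suc d) s (\<lambda>i. polar (Suc e) t (c i) l) i
      = f1 i l + s * f2 i l + t * f3 i l + (s * t) * f4 i l" for s t i l
    unfolding polar_def f1_def f2_def f3_def f4_def by (simp only: algebra_simps)
  have peel: "peel (Suc d) (Suc e) s t r c
      = (\<lambda>i l. f1 i l + s * f2 i l + t * f3 i l + (s * t) * f4 i l + (- r) * f4 i l)" for s t r
    by (intro ext) (simp only: peel_def pol f4_def, simp)
  have "A f1 + A f2 * s + A f3 * t + A f4 * s * t \<noteq> 0" if "Im s > 0" "Im t > 0" for s t
    using stable2_polar[OF assms(1) that] xy
    unfolding stable2_def pol trunc_eval_add trunc_eval_cmult A_def by (simp add: algebra_simps)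
  from biaffine_nonzero[OF this assms(2,3,4)]
  show "trunc_eval d (\<lambda>i. trunc_eval e (peel (Suc d) (Suc e) \<zeta> \<omega> (of_real a) c i) y) x \<noteq> 0"
    unfolding peel trunc_eval_add trunc_eval_cmult A_def by (simp add: algebra_simps)
qed

subsection \<open>Walsh's convolution in two variables\<close>

text \<open>The value at \<open>x\<close> of the degree \<open>d\<close> Walsh convolution of \<open>x\<^sup>k\<close> with the polynomial with
  coefficients \<open>c\<close>.\<close>

definition walsh_eval :: "nat \<Rightarrow> nat \<Rightarrow> complex \<Rightarrow> (nat \<Rightarrow> complex) \<Rightarrow> complex" where
  "walsh_eval d k x c = (\<Sum>i\<le>d. c i * (if d \<le> k + i
     then fact k * fact i / (fact d * fact (k + i - d)) * x ^ (k + i - d) else 0))"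

lemma walsh_eval_add: "walsh_eval d k x (\<lambda>i. f i + g i) = walsh_eval d k x f + walsh_eval d k x g"
  by (simp add: walsh_eval_def sum.distrib ring_distribs)

lemma walsh_eval_cmult: "walsh_eval d k x (\<lambda>i. r * f i) = r * walsh_eval d k x f"
  by (simp add: walsh_eval_def sum_distrib_left mult.assoc)

text \<open>This serves the constant term of a factor \<open>x y - a\<close>. The term
  \<open>i = 0\<close> of the larger sum vanishes because \<open>k < Suc d\<close>, and the others
  are shifted by one.\<close>

lemma walsh_eval_Suc_left:
  assumes "k \<le> d"
  shows "walsh_eval (Suc d) k x c = walsh_eval d k x (\<lambda>i. of_nat (Suc i) * c (Suc i)) / of_nat (Suc d)"
  unfolding walsh_eval_def sum.atMost_Suc_shift sum_divide_distrib
  using assms by (auto intro!: sum.cong simp: mult_ac simp del: of_nat_Suc)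

text \<open>This serves the term \<open>x y\<close> of a factor \<open>x y - a\<close>. Comparing
  the coefficients of \<open>c\<close> comes down to \<open>k + 1 = (d - i) + (m + 1)\<close> where
  \<open>k + i = d + m\<close>.\<close>

lemma walsh_eval_Suc_Suc:
  assumes "k \<le> d"
  shows "walsh_eval (Suc d) (Suc k) x c = walsh_eval d k x (polar (Suc d) x c) / of_nat (Suc d)"
proof -
  define w where "w d k i = (if d \<le> k + i
     then fact k * fact i / (fact d * fact (k + i - d)) * x ^ (k + i - d) else 0)" for d k i
  have w0: "of_nat (Suc d) * w (Suc d) (Suc k) 0 = of_nat (Suc d) * w d k 0"
    using assms by (auto simp: w_def simp del: of_nat_Suc)
  have wS: "of_nat (Suc d) * w (Suc d) (Suc k) (Suc i)
      = of_nat (Suc d - Suc i) * w d k (Suc i) + x * (of_nat (Suc i) * w d k i)" if "i \<le> d" for i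
  proof (cases "d \<le> k + i")
    case True
    then obtain m where m: "k + i = d + m" using le_iff_add by blast
    then have m': "complex_of_nat k = of_nat d + of_nat m - of_nat i"
      by (metis add_diff_cancel_right' of_nat_add)
    have d: "of_nat (Suc d - Suc i) = (of_nat d - of_nat i :: complex)" using that by (simp add: of_nat_diff)
    define F :: complex where "F = fact k * fact (Suc i) / (fact d * fact (Suc m)) * x ^ Suc m"
    have "of_nat (Suc d) * w (Suc d) (Suc k) (Suc i)
        = of_nat (Suc d) * (fact (Suc k) * fact (Suc i) / (fact (Suc d) * fact (Suc m)) * x ^ Suc m)"
      using m by (simp add: w_def)
    also have "\<dots> = of_nat (Suc k) * F"
      unfolding F_def fact_Suc[of d] fact_Suc[of k] of_nat_mult by (simp del: of_nat_Suc fact_Suc)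
    finally have 1: "of_nat (Suc d) * w (Suc d) (Suc k) (Suc i) = of_nat (Suc k) * F" .
    have 2: "w d k (Suc i) = F" using m by (simp add: w_def F_def)
    have "x * (of_nat (Suc i) * w d k i) = x * (of_nat (Suc i) * (fact k * fact i / (fact d * fact m) * x ^ m))"
      using m by (simp add: w_def)
    also have "\<dots> = of_nat (Suc m) * F"
      unfolding F_def fact_Suc[of i] fact_Suc[of m] of_nat_mult by (simp del: of_nat_Suc fact_Suc)
    finally have 3: "x * (of_nat (Suc i) * w d k i) = of_nat (Suc m) * F" .
    show ?thesis
      unfolding d 1 2 3 by (simp add: m' algebra_simps)
  next
    case False
    show ?thesis
    proof (cases "d = Suc (k + i)")
      \<comment> \<open>At this border the left side and the first summand have exponent
        \<open>0\<close>, while \<open>w d k i\<close> is already \<open>0\<close>; here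
        \<open>d - i = k + 1\<close>.\<close>
      case True
      then have "of_nat (Suc d - Suc i) * w d k (Suc i) = of_nat (Suc k) * (fact k * fact (Suc i) / fact d)"
        by (simp add: w_def del: fact_Suc of_nat_Suc)
      moreover have "of_nat (Suc d) * w (Suc d) (Suc k) (Suc i)
          = of_nat (Suc d) * (fact (Suc k) * fact (Suc i) / fact (Suc d))"
        using True by (simp add: w_def del: fact_Suc of_nat_Suc)
      moreover have "\<dots> = of_nat (Suc k) * (fact k * fact (Suc i) / fact d)"
        unfolding fact_Suc[of d] fact_Suc[of k] of_nat_mult by (simp del: of_nat_Suc fact_Suc)
      ultimately show ?thesis using False by (simp add: w_def)
    next
      case ne: False
      with False show ?thesis by (simp add: w_def)
    qed
  qed
  have "of_nat (Suc d) * walsh_eval (Suc d) (Suc k) x c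
     = (\<Sum>i\<le>Suc d. c i * (of_nat (Suc d) * w (Suc d) (Suc k) i))"
    unfolding walsh_eval_def w_def[symmetric] sum_distrib_left by (simp only: mult_ac)
  also have "\<dots> = c 0 * (of_nat (Suc d) * w d k 0)
     + (\<Sum>i\<le>d. c (Suc i) * (of_nat (Suc d - Suc i) * w d k (Suc i) + x * (of_nat (Suc i) * w d k i)))"
    unfolding sum.atMost_Suc_shift w0 using wS by (intro arg_cong2[where f = "(+)"] sum.cong refl) auto
  also have "\<dots> = (\<Sum>i\<le>Suc d. c i * (of_nat (Suc d - i) * w d k i))
     + (\<Sum>i\<le>d. c (Suc i) * (x * (of_nat (Suc i) * w d k i)))"
    unfolding sum.atMost_Suc_shift by (simp add: ring_distribs sum.distrib)
  also have "\<dots> = walsh_eval d k x (polar (Suc d) x c)"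
    unfolding walsh_eval_def w_def[symmetric] polar_def
    by (simp add: ring_distribs sum.distrib mult_ac)
  finally show ?thesis by (simp add: field_simps del: of_nat_Suc)
qed

section \<open>Peeling off the roots of one operand\<close>

abbreviation nonneg_rooted :: "complex poly \<Rightarrow> bool" where
  "nonneg_rooted p \<equiv> p \<noteq> 0 \<and> (\<forall>z. poly p z = 0 \<longrightarrow> z \<in> \<real>\<^sub>\<ge>\<^sub>0)"

text \<open>This is the two-variable Walsh convolution of \<open>y^n p(x y)\<close> with the
  polynomial with coefficients \<open>c\<close>, taken at \<open>(x, y)\<close>: the monomial
  \<open>t^k\<close> of \<open>p\<close> becomes \<open>x^k y^(n + k)\<close>.\<close>

definition pairing :: "nat \<Rightarrow> nat \<Rightarrow> complex \<Rightarrow> complex \<Rightarrow> complex poly \<Rightarrow> (nat \<Rightarrow> nat \<Rightarrow> complex) \<Rightarrow> complex" where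
  "pairing d n x y p c = (\<Sum>k\<le>d. coeff p k * walsh_eval d k x (\<lambda>i. walsh_eval (d + n) (n + k) y (c i)))"

lemma walsh_eval_divide: "walsh_eval d k x (\<lambda>i. f i / r) = walsh_eval d k x f / r"
  using walsh_eval_cmult[of d k x "1 / r"] by simp

lemma polar_divide: "polar m \<zeta> (\<lambda>i. f i / r) = (\<lambda>i. polar m \<zeta> f i / r)"
  by (simp add: polar_def fun_eq_iff add_divide_distrib)

lemma walsh_eval_polar_swap:
  "walsh_eval d k x (polar m \<zeta> (\<lambda>i. walsh_eval e l y (c i)))
    = walsh_eval d k x (\<lambda>i. walsh_eval e l y (\<lambda>j. polar m \<zeta> (\<lambda>i. c i j) i))"
  by (simp add: polar_def[abs_def] walsh_eval_add walsh_eval_cmult)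

text \<open>Each monomial \<open>t^k\<close> of \<open>r\<close> contributes
  \<open>M (Suc k) - a * M k\<close>. In \<open>M (Suc k)\<close> both powers rise with the degree
  parameters, which gives the two polar derivatives; in \<open>M k\<close> neither does, which gives
  the mixed derivative.\<close>

lemma pairing_peel:
  assumes "degree r \<le> d"
  shows "pairing (Suc d) n x y ([:-a, 1:] * r) c
    = pairing d n x y r (peel (Suc d) (Suc (d + n)) x y a c) / (of_nat (Suc d) * of_nat (Suc (d + n)))"
proof -
  define M where "M k = walsh_eval (Suc d) k x (\<lambda>i. walsh_eval (Suc (d + n)) (n + k) y (c i))" for k
  define N where "N = (of_nat (Suc d) * of_nat (Suc (d + n)) :: complex)"
  have M: "M (Suc k) - a * M k
      = walsh_eval d k x (\<lambda>i. walsh_eval (d + n) (n + k) y (peel (Suc d) (Suc (d + n)) x y a c i)) / N"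
    if "k \<le> d" for k
  proof -
    have "M (Suc k) = walsh_eval d k x (polar (Suc d) x
        (\<lambda>i. walsh_eval (d + n) (n + k) y (polar (Suc (d + n)) y (c i)))) / N"
      unfolding M_def add_Suc_right using that
      by (simp add: walsh_eval_Suc_Suc polar_divide walsh_eval_divide N_def mult_ac del: of_nat_Suc)
    then have 1: "M (Suc k) = walsh_eval d k x (\<lambda>i. walsh_eval (d + n) (n + k) y (\<lambda>l. polar (Suc d) x
        (\<lambda>i. polar (Suc (d + n)) y (c i) l) i)) / N"
      unfolding walsh_eval_polar_swap .
    have 2: "M k = walsh_eval d k x (\<lambda>i. walsh_eval (d + n) (n + k) y 
          (\<lambda>l. of_nat (Suc i) * (of_nat (Suc l) * c (Suc i) (Suc l)))) / N"
      unfolding M_def using that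
      by (simp add: walsh_eval_Suc_left walsh_eval_divide walsh_eval_cmult N_def del: of_nat_Suc)
    show ?thesis
      unfolding peel_def[abs_def] diff_conv_add_uminus mult_minus_left[symmetric] walsh_eval_add walsh_eval_cmult 1 2
      by (simp add: diff_divide_distrib)
  qed
  have c0: "coeff r (Suc d) = 0" using assms by (simp add: coeff_eq_0)
  have "pairing (Suc d) n x y ([:-a, 1:] * r) c = (\<Sum>k\<le>Suc d. coeff ([:-a, 1:] * r) k * M k)"
    by (simp add: pairing_def M_def)
  also have "\<dots> = (\<Sum>k\<le>Suc d. (case k of 0 \<Rightarrow> 0 | Suc k \<Rightarrow> coeff r k) * M k) - (\<Sum>k\<le>Suc d. a * coeff r k * M k)"
    unfolding sum_subtractf[symmetric]
    by (intro sum.cong) (auto simp: coeff_pCons algebra_simps split: nat.splits)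
  also have "(\<Sum>k\<le>Suc d. (case k of 0 \<Rightarrow> 0 | Suc k \<Rightarrow> coeff r k) * M k) = (\<Sum>k\<le>d. coeff r k * M (Suc k))"
    unfolding sum.atMost_Suc_shift by simp
  also have "(\<Sum>k\<le>Suc d. a * coeff r k * M k) = (\<Sum>k\<le>d. a * coeff r k * M k)"
    using c0 by simp
  also have "(\<Sum>k\<le>d. coeff r k * M (Suc k)) - \<dots> = (\<Sum>k\<le>d. coeff r k * (M (Suc k) - a * M k))"
    by (simp add: sum_subtractf algebra_simps)
  also have "\<dots> = pairing d n x y r (peel (Suc d) (Suc (d + n)) x y a c) / N"
    by (simp add: M pairing_def sum_divide_distrib)
  finally show ?thesis unfolding N_def .
qed

text \<open>Removing a root of \<open>p\<close> turns \<open>c\<close> into its \<open>peel\<close>,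
  which is again free of zeros; at \<open>d = 0\<close> a nonzero multiple of the value at
  \<open>(x, y)\<close> is left. The induction needs arbitrary \<open>c\<close>, since
  \<open>peel\<close> does not preserve support on the diagonal \<open>l = n + i\<close>.\<close>

lemma pairing_nonzero:
  assumes "stable2 d (d + n) c" "Im x > 0" "Im y > 0" "degree p = d" "nonneg_rooted p"
  shows "pairing d n x y p c \<noteq> 0"
  using assms
proof (induction d arbitrary: p c)
  case 0
  have "walsh_eval n n y f = trunc_eval n f y" for f
    by (auto simp: walsh_eval_def trunc_eval_def intro!: sum.cong)
  then have "walsh_eval 0 0 x (\<lambda>i. walsh_eval n n y (c i)) = trunc_eval 0 (\<lambda>i. trunc_eval n (c i) y) x"
    by (simp add: walsh_eval_def trunc_eval_def)
  also have "\<dots> \<noteq> 0" using 0 by (simp add: stable2_def)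
  finally show ?case
    using 0 leading_coeff_0_iff[of p] by (simp add: pairing_def)
next
  case (Suc d)
  obtain b where b: "poly p b = 0"
    using fundamental_theorem_of_algebra[of p] Suc.prems(4) by (auto simp: constant_degree)
  then obtain r where r: "p = [:-b, 1:] * r" by (metis dvdE poly_eq_0_iff_dvd)
  obtain a where a: "b = of_real a" "a \<ge> 0"
    using Suc.prems(5) b by (auto elim!: nonneg_Reals_cases)
  have "r \<noteq> 0" using Suc.prems(5) r by auto
  then have deg: "degree r = d"
    using Suc.prems(4) by (simp add: r degree_mult_eq del: mult_pCons_left)
  have "nonneg_rooted r" using Suc.prems(5) r by auto
  then have "pairing d n x y r (peel (Suc d) (Suc (d + n)) x y b c) \<noteq> 0"
    using Suc.prems deg a by (intro Suc.IH) (auto intro!: stable2_peel)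
  then show ?case
    unfolding r using pairing_peel[of r d n x y b c] deg by (simp del: of_nat_Suc mult_pCons_left)
qed

section \<open>Return from two variables to the rectangular convolution\<close>

definition rect_eval :: "nat \<Rightarrow> nat \<Rightarrow> complex poly \<Rightarrow> complex poly \<Rightarrow> complex \<Rightarrow> complex" where
  "rect_eval d n p q z = (\<Sum>k\<le>d. \<Sum>i\<le>d. coeff p k * coeff q i *
     (if d \<le> k + i then (fact (n + k) * fact (n + i) * fact k * fact i) /
              (fact (d + n) * fact d * fact (k + i - d) * fact (n + k + i - d)) * z ^ (k + i - d) else 0))"

text \<open>With \<open>y^n q(x y)\<close> as the other operand, the Walsh factors for
  \<open>d\<close> in \<open>x\<close> and for \<open>d + n\<close> in \<open>y\<close> multiply to
  the factor of the rectangular convolution. The exponent of \<open>y\<close> exceeds that of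
  \<open>x\<close> by \<open>n\<close>.\<close>

lemma pairing_rect_eval:
  "pairing d n x y p (\<lambda>i l. if l = n + i then coeff q i else 0) = y ^ n * rect_eval d n p q (x * y)"
proof -
  let ?w = "\<lambda>k i. if d + n \<le> n + k + (n + i)
    then fact (n + k) * fact (n + i) / (fact (d + n) * fact (n + k + (n + i) - (d + n))) * y ^ (n + k + (n + i) - (d + n)) else 0"
  have w: "walsh_eval (d + n) (n + k) y (\<lambda>l. if l = n + i then coeff q i else 0) = coeff q i * ?w k i" if "i \<le> d" for k i
    unfolding walsh_eval_def if_distrib[of "\<lambda>x. x * _"] using that by (simp add: if_distrib[of "\<lambda>x. x * _"] sum.delta cong: if_cong) 
  have "walsh_eval d k x (\<lambda>i. walsh_eval (d + n) (n + k) y (\<lambda>l. if l = n + i then coeff q i else 0))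
     = y ^ n * (\<Sum>i\<le>d. coeff q i *
     (if d \<le> k + i then (fact (n + k) * fact (n + i) * fact k * fact i) /
              (fact (d + n) * fact d * fact (k + i - d) * fact (n + k + i - d)) * (x * y) ^ (k + i - d) else 0))" for k
    unfolding walsh_eval_def[of d] sum_distrib_left
  proof (intro sum.cong refl)
    fix i assume "i \<in> {..d}"
    then have i: "i \<le> d" by simp
    show "walsh_eval (d + n) (n + k) y (\<lambda>l. if l = n + i then coeff q i else 0) *
         (if d \<le> k + i then fact k * fact i / (fact d * fact (k + i - d)) * x ^ (k + i - d) else 0) =
         y ^ n * (coeff q i * (if d \<le> k + i
            then fact (n + k) * fact (n + i) * fact k * fact i /
                 (fact (d + n) * fact d * fact (k + i - d) * fact (n + k + i - d)) * (x * y) ^ (k + i - d) else 0))"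
    proof (cases "d \<le> k + i")
      case True
      then obtain m where m: "k + i = d + m" using le_iff_add by blast
      then have "n + k + (n + i) - (d + n) = n + m" "n + k + i - d = n + m" "k + i - d = m" "d + n \<le> n + k + (n + i)" by auto
      then show ?thesis unfolding w[OF i] using True by (simp add: power_add power_mult_distrib mult_ac)
    qed simp
  qed
  then show ?thesis
    unfolding pairing_def rect_eval_def by (simp only: sum_distrib_left mult.assoc mult.left_commute)
qed

lemma upper_half_plane_sqrt:
  assumes "z \<notin> \<real>\<^sub>\<ge>\<^sub>0"
  obtains w where "Im w > 0" "w * w = z"
proof -
  define w where "w = (if Im (csqrt z) > 0 then csqrt z else - csqrt z)"
  have "w * w = z" by (simp add: w_def power2_eq_square[symmetric])
  moreover have "Im (csqrt z) \<noteq> 0"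
  proof
    assume "Im (csqrt z) = 0"
    then have "csqrt z = of_real (Re (csqrt z))" by (simp add: complex_eq_iff)
    then have "z = of_real ((Re (csqrt z))\<^sup>2)" by (metis of_real_power power2_csqrt)
    then show False using assms by (metis nonneg_Reals_of_real_iff zero_le_power2)
  qed
  then have "Im w > 0" unfolding w_def by (cases "Im (csqrt z) > 0") (auto simp del: csqrt.simps)
  ultimately show thesis using that by blast
qed

text \<open>Otherwise \<open>y\<close> would be a nonnegative multiple of the conjugate of
  \<open>x\<close>.\<close>

lemma mult_upper_half_plane:
  assumes "Im x > 0" "Im y > 0"
  shows "x * y \<notin> \<real>\<^sub>\<ge>\<^sub>0"
proof
  assume "x * y \<in> \<real>\<^sub>\<ge>\<^sub>0"
  then obtain t where t: "x * y = of_real t" "t \<ge> 0" by (auto elim: nonneg_Reals_cases)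
  have "x \<noteq> 0" using assms by auto
  then have "y = of_real t / x" using t by (simp add: field_simps)
  then have "Im y \<le> 0" using t assms by (simp add: Im_divide)
  then show False using assms by simp
qed

lemma poly_eq_sum_le:
  fixes p :: "'a::comm_semiring_1 poly"
  assumes "degree p \<le> d"
  shows "poly p x = (\<Sum>i\<le>d. coeff p i * x ^ i)"
  unfolding poly_altdef using assms
  by (intro sum.mono_neutral_left) (auto simp: coeff_eq_0)

lemma rect_eval_nonzero_full:
  assumes "nonneg_rooted p" "degree p = d" "nonneg_rooted q" "degree q \<le> d" "z \<notin> \<real>\<^sub>\<ge>\<^sub>0"
  shows "rect_eval d n p q z \<noteq> 0"
proof -
  let ?c = "\<lambda>i l. if l = n + i then coeff q i else 0"
  obtain w where w: "Im w > 0" "w * w = z" using upper_half_plane_sqrt[OF assms(5)] .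
  have "stable2 d (d + n) ?c"
    unfolding stable2_def
  proof (intro allI impI)
    fix x y :: complex assume xy: "Im x > 0" "Im y > 0"
    have "trunc_eval d (\<lambda>i. trunc_eval (d + n) (?c i) y) x = (\<Sum>i\<le>d. y ^ n * (coeff q i * (x * y) ^ i))"
      unfolding trunc_eval_def by (intro sum.cong) (auto simp: if_distrib[of "\<lambda>x. x * _"] power_add power_mult_distrib cong: if_cong)
    also have "\<dots> = y ^ n * poly q (x * y)"
      unfolding poly_eq_sum_le[OF assms(4)] sum_distrib_left ..
    also have "\<dots> \<noteq> 0" using xy assms(3) mult_upper_half_plane[OF xy] by auto
    finally show "trunc_eval d (\<lambda>i. trunc_eval (d + n) (?c i) y) x \<noteq> 0" .
  qed
  \<comment> \<open>At \<open>(w, w)\<close> the pairing is \<open>w ^ n\<close> times the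
    convolution at \<open>w * w = z\<close>.\<close>
  from pairing_nonzero[OF this w(1) w(1) assms(2,1)] show ?thesis
    unfolding pairing_rect_eval w by simp
qed

subsection \<open>Lowering the degree parameter\<close>

text \<open>For \<open>z\<close> outside \<open>[0, \<infinity>)\<close> all points
  \<open>1 / (z - b)\<close> lie in one open half plane with \<open>0\<close> on its boundary, so
  their mean is not \<open>0\<close>. The position of \<open>z\<close> decides which half plane is
  taken.\<close>

lemma nonneg_rooted_pderiv:
  assumes "nonneg_rooted q" "degree q > 0"
  shows "nonneg_rooted (pderiv q)"
proof
  show "pderiv q \<noteq> 0" using assms by (simp add: pderiv_eq_0_iff)
  obtain m where m: "degree q = Suc m" using assms(2) by (cases "degree q") auto
  have "poly (pderiv q) z \<noteq> 0" if z: "z \<notin> \<real>\<^sub>\<ge>\<^sub>0" for z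
  proof -
    have qz: "poly q z \<noteq> 0" using assms z by blast
    have b: "Im b = 0" "Re b \<ge> 0" "z - b \<noteq> 0" if "poly q b = 0" for b
      using assms that z by (auto simp: complex_nonneg_Reals_iff)
    have pos: "(Re z - Re b)\<^sup>2 + (Im z - Im b)\<^sup>2 > 0" if "poly q b = 0" for b
      using b(3)[OF that] by (simp add: complex_eq_iff sum_power2_gt_zero_iff)
    have "\<exists>K. convex K \<and> 0 \<notin> K \<and> (\<forall>b. poly q b = 0 \<longrightarrow> 1 / (z - b) \<in> K)"
    proof -
      consider "Im z > 0" | "Im z < 0" | "Im z = 0" "Re z < 0"
        using z by (fastforce simp: complex_nonneg_Reals_iff)
      then show ?thesis
      proof cases
        case 1
        then show ?thesis using b pos
          by (intro exI[of _ "{w. Im w < 0}"]) (auto simp: convex_halfspace_Im_lt Im_divide divide_neg_pos)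
      next
        case 2
        then show ?thesis using b pos
          by (intro exI[of _ "{w. Im w > 0}"]) (auto simp: convex_halfspace_Im_gt Im_divide divide_neg_pos)
      next
        case 3
        then show ?thesis using b pos
          by (intro exI[of _ "{w. Re w < 0}"]) (fastforce simp: convex_halfspace_Re_lt Re_divide intro!: divide_neg_pos)
      qed
    qed
    then obtain K where "convex K" "0 \<notin> K" "\<And>b. poly q b = 0 \<Longrightarrow> 1 / (z - b) \<in> K" by blast
    then have "poly (pderiv q) z / poly q z / of_nat (Suc m) \<noteq> 0"
      using log_deriv_in_convex[OF _ m qz] by metis
    then show ?thesis by auto
  qed
  then show "\<forall>z. poly (pderiv q) z = 0 \<longrightarrow> z \<in> \<real>\<^sub>\<ge>\<^sub>0" by blast
qed

text \<open>This is \<open>z^(-n) D z^(n + 1) D\<close>. It maps \<open>x^i\<close> to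
  \<open>i (n + i) x^(i - 1)\<close>, which matches the change of the factorials in the convolution
  when \<open>i\<close> and \<open>d\<close> drop by one together.\<close>

definition bessel_op :: "nat \<Rightarrow> complex poly \<Rightarrow> complex poly" where
  "bessel_op n q = smult (of_nat (Suc n)) (pderiv q) + pCons 0 (pderiv (pderiv q))"

lemma coeff_bessel_op:
  "coeff (bessel_op n q) k = of_nat (Suc k) * of_nat (Suc (n + k)) * coeff q (Suc k)"
  by (cases k) (simp_all add: bessel_op_def coeff_pderiv algebra_simps)

lemma degree_bessel_op:
  assumes "degree q = Suc m"
  shows "degree (bessel_op n q) = m"
proof (rule antisym)
  show "degree (bessel_op n q) \<le> m"
    using assms by (intro degree_le) (auto simp: coeff_bessel_op coeff_eq_0)
  have "coeff q (Suc m) \<noteq> 0" using assms leading_coeff_0_iff[of q] by auto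
  then show "m \<le> degree (bessel_op n q)"
    by (intro le_degree) (simp add: coeff_bessel_op del: of_nat_Suc)
qed

text \<open>Multiplying \<open>pderiv q\<close> by \<open>z^(n + 1)\<close> adds only the root
  \<open>0\<close>, and the derivative of the product is \<open>z^n\<close> times
  \<open>bessel_op n q\<close>. So \<open>nonneg_rooted_pderiv\<close> is used twice.\<close>

lemma nonneg_rooted_bessel_op:
  assumes "nonneg_rooted q" "degree q > 0"
  shows "nonneg_rooted (bessel_op n q)"
proof
  obtain m where m: "degree q = Suc m" using assms(2) by (cases "degree q") auto
  then have "coeff (bessel_op n q) m \<noteq> 0"
    using assms leading_coeff_0_iff[of q] by (simp add: coeff_bessel_op del: of_nat_Suc)
  then show "bessel_op n q \<noteq> 0" by auto
  let ?r = "monom 1 (Suc n) * pderiv q"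
  have q': "nonneg_rooted (pderiv q)" using nonneg_rooted_pderiv[OF assms] .
  then have "degree ?r = Suc n + degree (pderiv q)" 
    by (subst degree_mult_eq) (auto simp: degree_monom_eq monom_eq_0_iff)
  moreover have "nonneg_rooted ?r" using q' by (auto simp: poly_monom monom_eq_0_iff)
  ultimately have r: "nonneg_rooted (pderiv ?r)" by (intro nonneg_rooted_pderiv) auto
  have "poly (pderiv ?r) z = z ^ n * poly (bessel_op n q) z" for z
    by (simp add: pderiv_mult pderiv_monom poly_monom bessel_op_def algebra_simps)
  then show "\<forall>z. poly (bessel_op n q) z = 0 \<longrightarrow> z \<in> \<real>\<^sub>\<ge>\<^sub>0" using r by auto
qed

lemma rect_eval_Suc:
  assumes "degree p \<le> d"
  shows "rect_eval (Suc d) n p q z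
    = rect_eval d n p (bessel_op n q) z / (of_nat (Suc d) * of_nat (Suc (d + n)))"
proof -
  define w :: "nat \<Rightarrow> nat \<Rightarrow> nat \<Rightarrow> complex" where
    "w d k i = (if d \<le> k + i then (fact (n + k) * fact (n + i) * fact k * fact i) /
      (fact (d + n) * fact d * fact (k + i - d) * fact (n + k + i - d)) * z ^ (k + i - d) else 0)" for d k i
  have w: "rect_eval d n p q z = (\<Sum>k\<le>d. \<Sum>i\<le>d. coeff p k * coeff q i * w d k i)" for d p q
    by (simp add: rect_eval_def w_def)
  have wS: "w (Suc d) k (Suc i)
      = of_nat (Suc i) * of_nat (Suc (n + i)) * w d k i / (of_nat (Suc d) * of_nat (Suc (d + n)))" for k i
    by (simp add: w_def mult_ac del: of_nat_Suc)
  have "coeff p (Suc d) = 0" using assms by (simp add: coeff_eq_0)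
  then have "rect_eval (Suc d) n p q z = (\<Sum>k\<le>d. \<Sum>i\<le>Suc d. coeff p k * coeff q i * w (Suc d) k i)"
    by (simp add: w)
  also have "\<dots> = (\<Sum>k\<le>d. \<Sum>i\<le>d. coeff p k * coeff q (Suc i) * w (Suc d) k (Suc i))"
    unfolding sum.atMost_Suc_shift by (intro sum.cong) (auto simp: w_def)
  also have "\<dots> = rect_eval d n p (bessel_op n q) z / (of_nat (Suc d) * of_nat (Suc (d + n)))"
    unfolding w sum_divide_distrib by (intro sum.cong refl) (simp add: wS coeff_bessel_op del: of_nat_Suc)
  finally show ?thesis .
qed

text \<open>The parameter \<open>d\<close> is lowered until it equals \<open>degree p\<close>. Each
  step lowers \<open>degree q\<close> as well, so the degree bounds persist, and as long as
  \<open>degree p < d\<close> the bound \<open>d \<le> degree p + degree q\<close> keeps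
  \<open>degree q\<close> positive.\<close>

lemma rect_eval_nonzero:
  assumes "nonneg_rooted p" "nonneg_rooted q" "degree p \<le> d" "degree q \<le> d" "d \<le> degree p + degree q" "z \<notin> \<real>\<^sub>\<ge>\<^sub>0"
  shows "rect_eval d n p q z \<noteq> 0"
  using assms
proof (induction d arbitrary: q)
  case 0
  then show ?case by (intro rect_eval_nonzero_full) auto
next
  case (Suc d)
  show ?case
  proof (cases "degree p = Suc d")
    case True
    then show ?thesis using Suc.prems by (intro rect_eval_nonzero_full) auto
  next
    case False
    with Suc.prems have p: "degree p \<le> d" and "degree q > 0" by auto
    then obtain m where m: "degree q = Suc m" by (cases "degree q") auto
    have "rect_eval d n p (bessel_op n q) z \<noteq> 0"
      using Suc.prems p m degree_bessel_op[OF m, of n] \<open>degree q > 0\<close>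
      by (intro Suc.IH nonneg_rooted_bessel_op) auto
    then show ?thesis unfolding rect_eval_Suc[OF p] by (simp del: of_nat_Suc)
  qed
qed

subsection \<open>Leading coefficients and the classes of polynomials\<close>

lemma map_poly_of_real_add:
  "map_poly complex_of_real (p + q) = map_poly complex_of_real p + map_poly complex_of_real q"
  by (intro poly_eqI) (simp add: coeff_map_poly)

lemma map_poly_of_real_sum:
  "map_poly complex_of_real (sum f A) = (\<Sum>x\<in>A. map_poly complex_of_real (f x))"
  by (induction A rule: infinite_finite_induct) (simp_all add: map_poly_of_real_add)

lemma poly_rect_conv:
  "poly (map_poly complex_of_real (rect_conv d n p q)) z
    = rect_eval d n (map_poly complex_of_real p) (map_poly complex_of_real q) z"
  unfolding rect_conv_def rect_eval_def map_poly_of_real_sum poly_sum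
  by (intro sum.cong refl)
     (auto simp: rect_conv_monom_def smult_monom map_poly_monom poly_monom coeff_map_poly add.commute add.left_commute)

lemma coeff_rect_conv_above:
  assumes "m > degree p + degree q - d"
  shows "coeff (rect_conv d n p q) m = 0"
proof -
  have "coeff p k * coeff q l * coeff (rect_conv_monom d n k l) m = 0" for k l
  proof (cases "k \<le> degree p \<and> l \<le> degree q")
    case True
    then have "k + l - d < m" using assms by linarith
    then show ?thesis by (simp add: rect_conv_monom_def)
  next
    case False
    then have "coeff p k = 0 \<or> coeff q l = 0" by (auto simp: coeff_eq_0)
    then show ?thesis by auto
  qed
  then show ?thesis unfolding rect_conv_def coeff_sum coeff_smult by (intro sum.neutral ballI) simp
qed

text \<open>Only the pair of leading terms reaches this exponent. The quotient of factorials stays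
  hidden in \<open>c\<close>, because only its sign matters.\<close>

lemma coeff_rect_conv_top:
  assumes "degree p \<le> d" "degree q \<le> d" "d \<le> degree p + degree q"
  shows "\<exists>c>0. coeff (rect_conv d n p q) (degree p + degree q - d) = c * lead_coeff p * lead_coeff q"
proof -
  let ?i = "degree p" and ?j = "degree q"
  define m where "m = ?i + ?j - d"
  define c where "c = coeff (rect_conv_monom d n ?i ?j) m"
  have "coeff p k * coeff q l * coeff (rect_conv_monom d n k l) m
      = (if l = ?j then if k = ?i then lead_coeff p * lead_coeff q * c else 0 else 0)" for k l
  proof (cases "k \<le> ?i \<and> l \<le> ?j")
    case True
    then have "k + l - d \<noteq> m" if "d \<le> k + l" "\<not> (k = ?i \<and> l = ?j)" 
      using that assms unfolding m_def by linarith
    then show ?thesis by (auto simp: rect_conv_monom_def c_def)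
  next
    case False
    then have "coeff p k = 0 \<or> coeff q l = 0" by (auto simp: coeff_eq_0)
    with False show ?thesis by auto
  qed
  then have "coeff (rect_conv d n p q) m = lead_coeff p * lead_coeff q * c"
    using assms by (simp add: rect_conv_def coeff_sum)
  moreover have "c > 0" using assms by (simp add: c_def rect_conv_monom_def m_def)
  ultimately show ?thesis unfolding m_def by (metis mult.commute mult.left_commute)
qed

text \<open>Dividing out the full power of the variable leaves a cofactor without roots, hence a
  constant.\<close>

lemma poly_only_root_0:
  fixes q :: "complex poly"
  assumes "q \<noteq> 0" "\<And>z. poly q z = 0 \<Longrightarrow> z = 0"
  shows "q = monom (lead_coeff q) (degree q)"
proof -
  obtain r where r: "q = [:-0, 1:] ^ order 0 q * r" "\<not> [:-0, 1:] dvd r"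
    using order_decomp[OF assms(1)] by blast
  have "poly r z \<noteq> 0" for z
    using assms(2)[of z] r by (metis mult_zero_right poly_eq_0_iff_dvd poly_mult)
  then have "degree r = 0" using fundamental_theorem_of_algebra[of r] by (auto simp: constant_degree)
  then obtain c where "r = [:c:]" by (metis degree_eq_zeroE)
  then have "q = monom c (order 0 q)" using r(1) by (simp add: monom_altdef)
  moreover from this have "c \<noteq> 0" using assms(1) by auto
  ultimately show ?thesis by (metis degree_monom_eq coeff_monom)
qed

text \<open>The monomials added by the closure are the case without a positive root, where
  \<open>0\<close> is the only root. This merges both parts of the closure into one condition on
  roots.\<close>

lemma Pplus_closure_iff:
  assumes "1 \<le> k"
  shows "p \<in> Pplus_closure (int k)
    \<longleftrightarrow> degree p = k \<and> lead_coeff p > 0 \<and> nonneg_rooted (map_poly complex_of_real p)"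
    (is "_ \<longleftrightarrow> ?R")
proof
  assume "p \<in> Pplus_closure (int k)"
  then consider "p \<in> Pplus (int k)" | c where "p = monom c k" "c > 0"
    using assms by (auto simp: Pplus_closure_def)
  then show ?R
  proof cases
    case 1
    then have "map_poly complex_of_real p \<noteq> 0"
      using assms by (auto simp: Pplus_def map_poly_eq_0_iff)
    then show ?thesis using 1 assms by (auto simp: Pplus_def complex_nonneg_Reals_iff complex_is_Real_iff)
  next
    case 2
    then show ?thesis by (auto simp: degree_monom_eq map_poly_monom poly_monom monom_eq_0_iff)
  qed
next
  assume R: ?R
  let ?q = "map_poly complex_of_real p"
  show "p \<in> Pplus_closure (int k)"
  proof (cases "\<exists>x::real. x > 0 \<and> poly p x = 0")
    case True
    then show ?thesis
      using R assms by (auto simp: Pplus_closure_def Pplus_def complex_nonneg_Reals_iff complex_is_Real_iff)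
  next
    case False
    have "z = 0" if "poly ?q z = 0" for z
    proof -
      have "z \<in> \<real>\<^sub>\<ge>\<^sub>0" using R that by blast
      then obtain x where x: "z = of_real x" "x \<ge> 0" by (rule nonneg_Reals_cases)
      have "poly ?q (of_real x) = of_real (poly p x)"
        by (simp add: poly_altdef degree_map_poly coeff_map_poly)
      then have "poly p x = 0" using that x(1) by simp
      with False have "\<not> x > 0" by blast
      with x show ?thesis by simp
    qed
    then have eq: "?q = monom (lead_coeff ?q) (degree ?q)" using R by (intro poly_only_root_0) auto
    have deg: "degree ?q = k" using R by (simp add: degree_map_poly)
    have "p = monom (lead_coeff p) k"
    proof (rule poly_eqI)
      fix i
      have "of_real (coeff p i) = coeff (monom (lead_coeff ?q) (degree ?q)) i"
        by (subst eq[symmetric]) (simp add: coeff_map_poly)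
      then show "coeff p i = coeff (monom (lead_coeff p) k) i"
        using R unfolding deg by (auto simp: coeff_map_poly split: if_splits)
    qed
    then have "p \<in> {monom c k | c. c > 0}" using R by blast
    then show ?thesis using assms by (simp add: Pplus_closure_def)
  qed
qed

theorem theorem2p3:
  fixes d i j n :: nat and p q :: "real poly"
  assumes "1 \<le> i" and "i \<le> j" and "j \<le> d"
    and "p \<in> Pplus_closure (int i)" and "q \<in> Pplus_closure (int j)"
  shows "(i + j \<noteq> d \<longrightarrow> rect_conv d n p q \<in> Pplus_closure (int i + int j - int d)) \<and>
         (i + j = d \<longrightarrow> (\<exists>c>0. rect_conv d n p q = [:c:]))"
proof -
  let ?r = "rect_conv d n p q" and ?C = "map_poly complex_of_real"
  have p: "degree p = i" "lead_coeff p > 0" "nonneg_rooted (?C p)"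
    using assms Pplus_closure_iff[of i p] by auto
  have q: "degree q = j" "lead_coeff q > 0" "nonneg_rooted (?C q)"
    using assms Pplus_closure_iff[of j q] by auto
  have le: "i \<le> d" "j \<le> d" using assms by auto
  show ?thesis
  proof (cases "d \<le> i + j")
    case False
    have "coeff p k * coeff q l = 0" if "d \<le> k + l" for k l
    proof -
      have "degree p < k \<or> degree q < l" using False that p q by linarith
      then show ?thesis by (auto simp: coeff_eq_0)
    qed
    then have "?r = 0"
      unfolding rect_conv_def by (intro sum.neutral ballI) (simp add: rect_conv_monom_def)
    then show ?thesis using False by (simp add: Pplus_closure_def)
  next
    case True
    define m where "m = i + j - d"
    obtain c where c: "c > 0" "coeff ?r m = c * lead_coeff p * lead_coeff q"
      using coeff_rect_conv_top[of p d q n] p q le True unfolding m_def by auto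
    then have pos: "coeff ?r m > 0" using p q by simp
    have deg: "degree ?r = m"
    proof (rule antisym)
      show "degree ?r \<le> m"
        using p q by (intro degree_le allI impI coeff_rect_conv_above) (simp add: m_def)
      show "m \<le> degree ?r" using pos by (intro le_degree) simp
    qed
    show ?thesis
    \<comment> \<open>For \<open>m = 0\<close>, that is \<open>i + j = d\<close>, the convolution is
      a positive constant. For \<open>m > 0\<close> degree and leading coefficient are settled, and
      only the roots remain.\<close>
    proof (cases "m = 0")
      case True
      then have "?r = [:coeff ?r 0:]" using deg by (metis degree_eq_zeroE coeff_pCons_0)
      then show ?thesis using True \<open>d \<le> i + j\<close> pos m_def by (metis diff_is_0_eq le_antisym)
    next
      case False
      have "poly (?C ?r) z \<noteq> 0" if "z \<notin> \<real>\<^sub>\<ge>\<^sub>0" for z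
        unfolding poly_rect_conv
        using p q le True that by (intro rect_eval_nonzero) (simp_all add: degree_map_poly)
      moreover have "?C ?r \<noteq> 0" using pos by (auto simp: map_poly_eq_0_iff)
      ultimately have "?r \<in> Pplus_closure (int m)"
        using False deg pos by (subst Pplus_closure_iff) auto
      moreover have "int i + int j - int d = int m" using True by (simp add: m_def)
      moreover have "i + j \<noteq> d" using False by (auto simp: m_def)
      ultimately show ?thesis by simp
    qed
  qed
qed

end
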